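(* Let $\Lambda$ be a subset of the unit disk $\mathbb{D}$. The following properties are equivalent: (a) $\Lambda$ is a sampling set for $\mathcal{N}$. (b) $\Lambda$ is a determination set for $\mathcal{N}$. (c) $\Lambda$ is a strongly sampling set for $\mathcal{N}$.
   Context: $\mathbb{D}$ is the open unit disk in $\mathbb{C}$ and $\mathrm{Hol}(\mathbb{D})$ the holomorphic functions on it. The Nevanlinna class is $$\mathcal{N}=\Bigl\{f\in \mathrm{Hol}(\mathbb{D}):\lim_{r\to1}\frac1{2\pi}\int_0^{2\pi}\log^+|f(re^{i\theta})|\,d\theta<\infty\Bigr\}.$$ $\mathcal{H}^\infty$ is the space of bounded holomorphic functions on $\mathbb{D}$. $\mathrm{Har}_+(\mathbb{D})$ is the set of non-negative harmonic functions on $\mathbb{D}$. For $f\in\mathcal{N}$ put $N(f)=\inf\{h(0): h\in\mathrm{Har}_+(\mathbb{D}),\ \log(1+|f|)\le h \text{ on } \mathbb{D}\}$ and, for $\Lambda\subset\mathbb{D}$, $N(f|\Lambda)=\inf\{h(0): h\in\mathrm{Har}_+(\mathbb{D}),\ \log(1+|f(\lambda)|)\le h(\lambda)\ \forall\lambda\in\Lambda\}$. (One has $N(f)=\lim_{r\to1}\frac1{2\pi}\int_0^{2\pi}\log(1+|f(re^{i\theta})|)\,d\theta$.) $\Lambda$ is sampling for $\mathcal{N}$ if there exists $C>0$ such that $N(f)\le N(f|\Lambda)+C$ for all $f\in\mathcal{N}$. $\Lambda$ is a determination set for $\mathcal{N}$ if every $f\in\mathcal{N}$ with $\sup_\Lambda|f|<\infty$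 belongs to $\mathcal{H}^\infty$. $\Lambda$ is strongly sampling for $\mathcal{N}$ if whenever $f\in\mathcal{N}$ and $h\in\mathrm{Har}_+(\mathbb{D})$ satisfy $\log^+|f(\lambda)|\le h(\lambda)$ for all $\lambda\in\Lambda$, then $\log^+|f|\le h$ on $\mathbb{D}$. *)

theory Defs
  imports "HOL-Complex_Analysis.Complex_Analysis"
begin

abbreviation unit_disk :: "complex set"
  where "unit_disk \<equiv> ball 0 1"

(* Since ln 0 = 0 in HOL, this is also right at x = 0. *)
definition log_plus :: "real \<Rightarrow> real"
  where "log_plus x = max (ln x) 0"

(* u is twice continuously differentiable on S, for the real structure x + iy of the plane, and
   u_xx + u_yy = 0.  The partial derivatives are given through Frechet derivatives, so that
   their existence is part of the definition. The intended S are open. *)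
definition harmonic_on :: "(complex \<Rightarrow> real) \<Rightarrow> complex set \<Rightarrow> bool"  (infixl "harmonic'_on" 50)
  where "u harmonic_on S \<longleftrightarrow>
    (\<exists>ux uy uxx uxy uyx uyy.
       (\<forall>z\<in>S. (u has_derivative (\<lambda>v. Re v * ux z + Im v * uy z)) (at z)) \<and>
       (\<forall>z\<in>S. (ux has_derivative (\<lambda>v. Re v * uxx z + Im v * uxy z)) (at z)) \<and>
       (\<forall>z\<in>S. (uy has_derivative (\<lambda>v. Re v * uyx z + Im v * uyy z)) (at z)) \<and>
       continuous_on S uxx \<and> continuous_on S uxy \<and>
       continuous_on S uyx \<and> continuous_on S uyy \<and>
       (\<forall>z\<in>S. uxx z + uyy z = 0))"

(* Functions on the disk are total functions on the complex plane; every notion below depends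
   only on their values in the disk. *)
definition Har_plus :: "(complex \<Rightarrow> real) set"
  where "Har_plus = {h. h harmonic_on unit_disk \<and> (\<forall>z\<in>unit_disk. 0 \<le> h z)}"

(* The limit is a real number L, i.e. it exists and is finite. *)
definition Nevanlinna :: "(complex \<Rightarrow> complex) set"
  where "Nevanlinna = {f. f holomorphic_on unit_disk \<and>
    (\<exists>L. ((\<lambda>r. 1 / (2 * pi) * integral {0..2 * pi} (\<lambda>\<theta>. log_plus (norm (f (rcis r \<theta>)))))
            \<longlongrightarrow> L) (at_left 1))}"

definition H_infinity :: "(complex \<Rightarrow> complex) set"
  where "H_infinity = {f. f holomorphic_on unit_disk \<and> bounded (f ` unit_disk)}"

(* Infima of sets of reals, bounded below by 0. For f in the Nevanlinna class the sets are
   nonempty, because log (1 + |f|) then has a harmonic majorant. *)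
definition Nev_N :: "(complex \<Rightarrow> complex) \<Rightarrow> real"
  where "Nev_N f = Inf {h 0 | h. h \<in> Har_plus \<and> (\<forall>z\<in>unit_disk. ln (1 + norm (f z)) \<le> h z)}"

definition Nev_N_on :: "(complex \<Rightarrow> complex) \<Rightarrow> complex set \<Rightarrow> real"
  where "Nev_N_on f \<Lambda> = Inf {h 0 | h. h \<in> Har_plus \<and> (\<forall>w\<in>\<Lambda>. ln (1 + norm (f w)) \<le> h w)}"

definition sampling_set :: "complex set \<Rightarrow> bool"
  where "sampling_set \<Lambda> \<longleftrightarrow> (\<exists>C>0. \<forall>f\<in>Nevanlinna. Nev_N f \<le> Nev_N_on f \<Lambda> + C)"

definition determination_set :: "complex set \<Rightarrow> bool"
  where "determination_set \<Lambda> \<longleftrightarrow>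
    (\<forall>f\<in>Nevanlinna. bdd_above ((\<lambda>z. norm (f z)) ` \<Lambda>) \<longrightarrow> f \<in> H_infinity)"

definition strongly_sampling_set :: "complex set \<Rightarrow> bool"
  where "strongly_sampling_set \<Lambda> \<longleftrightarrow>
    (\<forall>f\<in>Nevanlinna. \<forall>h\<in>Har_plus.
       (\<forall>w\<in>\<Lambda>. log_plus (norm (f w)) \<le> h w) \<longrightarrow>
       (\<forall>z\<in>unit_disk. log_plus (norm (f z)) \<le> h z))"

end

theory Submission
  imports Defs
begin

text \<open>
  All three properties are equivalent to the following one: if \<open>f\<close> is in the Nevanlinna class and
  \<open>|f| \<le> 1\<close> on \<open>\<Lambda>\<close>, then \<open>|f| \<le> 1\<close> on the disk (\<open>propagates_unit_bound\<close>).

  A sampling set has it by the power trick. If \<open>|f| \<le> 1\<close> on \<open>\<Lambda>\<close>, then every power of \<open>f\<close> has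
  \<open>N(f\<^sup>n|\<Lambda>) \<le> ln 2\<close>, so \<open>log (1 + |f|\<^sup>n)\<close> has positive harmonic majorants whose values at the origin
  stay bounded as \<open>n\<close> grows. By Harnack's inequality \<open>n log\<^sup>+ |f(z)|\<close> is bounded for each fixed \<open>z\<close>,
  hence \<open>log\<^sup>+ |f(z)| = 0\<close>.

  A determination set has it because a function that is bounded but exceeds \<open>1\<close> somewhere can be
  turned into an unbounded one. Let \<open>\<zeta>\<close> be a point of maximal modulus in the closure of the range of
  \<open>f\<close>. If \<open>f\<close> is not constant, then \<open>\<zeta> / (\<zeta> - f)\<close> is holomorphic and unbounded on the disk and bounded
  on \<open>\<Lambda>\<close>. It has non-negative real part, and this puts it in the Nevanlinna class.

  Conversely, the property gives strong sampling: a positive harmonic function is \<open>h = Re g\<close> with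
  \<open>g\<close> holomorphic, and \<open>log\<^sup>+ |f| \<le> h\<close> says exactly that \<open>|f / exp g| \<le> 1\<close>. Strong sampling implies
  the two other notions at once, by constant \<open>h\<close> and by \<open>log (1 + x) \<le> log 2 + log\<^sup>+ x\<close>.

  The analytic basis is the classical fact that \<open>f\<close> is in the Nevanlinna class if and only if
  \<open>log\<^sup>+ |f|\<close> has a positive harmonic majorant (\<open>Nevanlinna_if_majorant\<close>, \<open>Nevanlinna_has_majorant\<close>).
  The Poisson kernel and the theory of subharmonic functions are avoided as follows. On the unit
  circle a continuous function is uniformly close to the real part of an entire function \<open>q\<close>
  (Stone-Weierstrass). If \<open>Re q\<close> lies slightly above \<open>log\<^sup>+ |f(rz)|\<close> on the circle, then the maximum
  modulus principle for \<open>f(rz) exp (-q(z))\<close> carries the inequality into the disk, and \<open>Re q(0)\<close>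
  is almost the circle mean of \<open>log\<^sup>+ |f|\<close> (\<open>entire_majorant\<close>). This makes the means monotone in the
  radius, and Montel's theorem extracts a majorant on the whole disk as \<open>r\<close> tends to \<open>1\<close>.
\<close>

section \<open>Harmonic functions on the disk as real parts\<close>

text \<open>
  The mean value theorem in the first variable and then in the second. Exchanging the variables
  leaves the left-hand side of the equation unchanged, and this is what makes mixed partial
  derivatives commute.
\<close>
lemma double_difference_mean_value:
  fixes F A B :: "real \<Rightarrow> real \<Rightarrow> real"
  assumes "0 < h"
    and F: "\<And>x y. 0 \<le> x \<Longrightarrow> x \<le> h \<Longrightarrow> 0 \<le> y \<Longrightarrow> y \<le> h \<Longrightarrow>
              ((\<lambda>x. F x y) has_real_derivative A x y) (at x)"
    and A: "\<And>x y. 0 \<le> x \<Longrightarrow> x \<le> h \<Longrightarrow> 0 \<le> y \<Longrightarrow> y \<le> h \<Longrightarrow>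
              ((\<lambda>y. A x y) has_real_derivative B x y) (at y)"
  obtains x y where "0 < x" "x < h" "0 < y" "y < h"
    "F h h - F h 0 - F 0 h + F 0 0 = h * h * B x y"
proof -
  have "\<exists>x. 0 < x \<and> x < h \<and>
      (F h h - F h 0) - (F 0 h - F 0 0) = (h - 0) * (A x h - A x 0)"
    using \<open>0 < h\<close> by (intro MVT2[where f = "\<lambda>x. F x h - F x 0"] DERIV_diff F) auto
  then obtain x where x: "0 < x" "x < h"
    and 1: "(F h h - F h 0) - (F 0 h - F 0 0) = (h - 0) * (A x h - A x 0)" by blast
  have "\<exists>y. 0 < y \<and> y < h \<and> A x h - A x 0 = (h - 0) * B x y"
    using \<open>0 < h\<close> x by (intro MVT2 A) auto
  then obtain y where y: "0 < y" "y < h" and 2: "A x h - A x 0 = (h - 0) * B x y" by blast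
  show ?thesis
    by (rule that[OF x y]) (use 1 2 in \<open>simp add: algebra_simps\<close>)
qed

text \<open>
  If the two values differed, then by continuity they would stay apart on small squares at \<open>z0\<close>;
  but on every such square the double difference of \<open>u\<close> is a common value of both derivatives, up
  to the factor \<open>h\<^sup>2\<close>.
\<close>
lemma mixed_partials_eq:
  fixes u ux uy uxy uyx :: "complex \<Rightarrow> real"
  assumes "open S" "z0 \<in> S"
    and u: "\<And>z. z \<in> S \<Longrightarrow> (u has_derivative (\<lambda>v. Re v * ux z + Im v * uy z)) (at z)"
    and ux: "\<And>z. z \<in> S \<Longrightarrow> (ux has_derivative (\<lambda>v. Re v * uxx z + Im v * uxy z)) (at z)"
    and uy: "\<And>z. z \<in> S \<Longrightarrow> (uy has_derivative (\<lambda>v. Re v * uyx z + Im v * uyy z)) (at z)"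
    and "continuous_on S uxy" "continuous_on S uyx"
  shows "uxy z0 = uyx z0"
proof (rule ccontr)
  define P where "P x y = z0 + Complex x y" for x y
  have dx: "((\<lambda>x. f (P x y)) has_real_derivative a) (at x)"
    if "(f has_derivative (\<lambda>v. Re v * a + Im v * b)) (at (P x y))" for f a b x y
  proof -
    have "((\<lambda>x. P x y) has_derivative (\<lambda>v. complex_of_real v)) (at x)"
      unfolding P_def Complex_eq by (auto intro!: derivative_eq_intros)
    from has_derivative_compose[OF this that]
    show ?thesis by (simp add: has_field_derivative_def mult.commute[of _ a])
  qed
  have dy: "((\<lambda>y. f (P x y)) has_real_derivative b) (at y)"
    if "(f has_derivative (\<lambda>v. Re v * a + Im v * b)) (at (P x y))" for f a b x y
  proof -
    have "((\<lambda>y. P x y) has_derivative (\<lambda>v. \<i> * complex_of_real v)) (at y)"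
      unfolding P_def Complex_eq by (auto intro!: derivative_eq_intros)
    from has_derivative_compose[OF this that]
    show ?thesis by (simp add: has_field_derivative_def mult.commute[of _ b])
  qed
  assume ne: "uxy z0 \<noteq> uyx z0"
  define e where "e = \<bar>uxy z0 - uyx z0\<bar> / 2"
  have "e > 0" using ne by (simp add: e_def)
  obtain d0 where d0: "d0 > 0" "ball z0 d0 \<subseteq> S" using assms(1,2) openE by blast
  have "isCont uxy z0" "isCont uyx z0"
    using assms(1,2,6,7) continuous_on_eq_continuous_at by blast+
  then obtain d1 d2 where d1: "d1 > 0" "\<And>z. dist z z0 < d1 \<Longrightarrow> dist (uxy z) (uxy z0) < e"
    and d2: "d2 > 0" "\<And>z. dist z z0 < d2 \<Longrightarrow> dist (uyx z) (uyx z0) < e"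
    using \<open>e > 0\<close> unfolding continuous_at_eps_delta by metis
  \<comment> \<open>Points of a square with side \<open>h\<close> at \<open>z0\<close> are within \<open>2 h\<close> of \<open>z0\<close>; the factor 4 makes this strict.\<close>
  define h where "h = min d0 (min d1 d2) / 4"
  have h: "h > 0" using d0 d1 d2 by (simp add: h_def)
  have P: "dist (P x y) z0 < d0" "dist (P x y) z0 < d1" "dist (P x y) z0 < d2" "P x y \<in> S"
    if "0 \<le> x" "x \<le> h" "0 \<le> y" "y \<le> h" for x y
  proof -
    have "norm (Complex x y) \<le> \<bar>x\<bar> + \<bar>y\<bar>" using cmod_le[of "Complex x y"] by simp
    then have "dist (P x y) z0 < 4 * h" using that h by (simp add: P_def dist_norm)
    then show "dist (P x y) z0 < d0" "dist (P x y) z0 < d1" "dist (P x y) z0 < d2"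
      by (auto simp: h_def)
    then show "P x y \<in> S" using d0 by (auto simp: dist_commute subset_iff)
  qed
  have Dx: "((\<lambda>x. u (P x y)) has_real_derivative ux (P x y)) (at x)"
      "((\<lambda>x. uy (P x y)) has_real_derivative uyx (P x y)) (at x)"
    and Dy: "((\<lambda>y. u (P x y)) has_real_derivative uy (P x y)) (at y)"
      "((\<lambda>y. ux (P x y)) has_real_derivative uxy (P x y)) (at y)"
    if "0 \<le> x" "x \<le> h" "0 \<le> y" "y \<le> h" for x y
    using dx[OF u[OF P(4)[OF that]]] dx[OF uy[OF P(4)[OF that]]]
      dy[OF u[OF P(4)[OF that]]] dy[OF ux[OF P(4)[OF that]]] by this+
  obtain x y where xy: "0 < x" "x < h" "0 < y" "y < h"
    "u (P h h) - u (P h 0) - u (P 0 h) + u (P 0 0) = h * h * uxy (P x y)"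
    using double_difference_mean_value[of h "\<lambda>x y. u (P x y)" "\<lambda>x y. ux (P x y)" "\<lambda>x y. uxy (P x y)", OF h Dx(1) Dy(2)] by blast
  obtain y' x' where xy': "0 < y'" "y' < h" "0 < x'" "x' < h"
    "u (P h h) - u (P 0 h) - u (P h 0) + u (P 0 0) = h * h * uyx (P x' y')"
    using double_difference_mean_value[of h "\<lambda>y x. u (P x y)" "\<lambda>y x. uy (P x y)" "\<lambda>y x. uyx (P x y)", OF h Dy(1) Dx(2)] by blast
  have "h * h * uxy (P x y) = h * h * uyx (P x' y')" using xy(5) xy'(5) by linarith
  then have "uxy (P x y) = uyx (P x' y')" using h by simp
  moreover have "dist (uxy (P x y)) (uxy z0) < e" "dist (uyx (P x' y')) (uyx z0) < e"
    using xy xy' by (auto intro!: d1 d2 P)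
  ultimately show False by (auto simp: e_def dist_real_def abs_if split: if_splits)
qed

lemma harmonic_on_Re:
  assumes "g holomorphic_on S" "open S"
  shows "(\<lambda>z. Re (g z)) harmonic_on S"
proof -
  have *: "(g has_field_derivative deriv g z) (at z)"
          "(deriv g has_field_derivative deriv (deriv g) z) (at z)" if "z \<in> S" for z
    using assms that by (auto intro: holomorphic_derivI holomorphic_deriv)
  have c: "continuous_on S (deriv (deriv g))"
    using assms by (intro holomorphic_on_imp_continuous_on holomorphic_deriv)
  have Re: "((\<lambda>z. Re (k z)) has_derivative (\<lambda>v. Re v * Re k' + Im v * - Im k')) (at z)"
    and Im: "((\<lambda>z. - Im (k z)) has_derivative (\<lambda>v. Re v * - Im k' + Im v * - Re k')) (at z)"
    if "(k has_field_derivative k') (at z)" for k k' z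
    using has_derivative_Re[OF that[unfolded has_field_derivative_def]]
      has_derivative_minus[OF has_derivative_Im[OF that[unfolded has_field_derivative_def]]]
    by (simp_all add: algebra_simps)
  let ?g' = "deriv g" and ?g'' = "deriv (deriv g)"
  have "continuous_on S (\<lambda>z. Re (?g'' z))" "continuous_on S (\<lambda>z. - Im (?g'' z))"
    "continuous_on S (\<lambda>z. - Re (?g'' z))"
    using c by (auto intro!: continuous_intros)
  with Re[OF *(1)] Re[OF *(2)] Im[OF *(2)] show ?thesis
    unfolding harmonic_on_def
    apply (rule_tac x = "\<lambda>z. Re (?g' z)" in exI, rule_tac x = "\<lambda>z. - Im (?g' z)" in exI)
    apply (rule_tac x = "\<lambda>z. Re (?g'' z)" in exI, rule_tac x = "\<lambda>z. - Im (?g'' z)" in exI)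
    apply (rule_tac x = "\<lambda>z. - Im (?g'' z)" in exI, rule_tac x = "\<lambda>z. - Re (?g'' z)" in exI)
    by simp
qed

text \<open>
  The function \<open>u\<^sub>x - \<i> u\<^sub>y\<close> satisfies the Cauchy-Riemann equations: one is the symmetry of the
  second derivatives, the other is the Laplace equation. Its primitive on the disk has real part
  \<open>u\<close> up to a constant.
\<close>
lemma harmonic_on_disk_eq_Re:
  assumes "u harmonic_on unit_disk"
  obtains g where "g holomorphic_on unit_disk" "Im (g 0) = 0" "\<And>z. z \<in> unit_disk \<Longrightarrow> u z = Re (g z)"
proof -
  obtain ux uy uxx uxy uyx uyy where
    u: "\<And>z. z \<in> unit_disk \<Longrightarrow> (u has_derivative (\<lambda>v. Re v * ux z + Im v * uy z)) (at z)" and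
    ux: "\<And>z. z \<in> unit_disk \<Longrightarrow> (ux has_derivative (\<lambda>v. Re v * uxx z + Im v * uxy z)) (at z)" and
    uy: "\<And>z. z \<in> unit_disk \<Longrightarrow> (uy has_derivative (\<lambda>v. Re v * uyx z + Im v * uyy z)) (at z)" and
    c: "continuous_on unit_disk uxy" "continuous_on unit_disk uyx" and
    lap: "\<And>z. z \<in> unit_disk \<Longrightarrow> uxx z + uyy z = 0"
    using assms unfolding harmonic_on_def by blast
  have sym: "uxy z = uyx z" if "z \<in> unit_disk" for z
    using mixed_partials_eq[OF open_ball that u ux uy c] .
  define G where "G z = Complex (ux z) (- uy z)" for z
  have G: "(G has_field_derivative Complex (uxx z) (- uyx z)) (at z)" if z: "z \<in> unit_disk" for z
  proof -
    have "(G has_derivative (\<lambda>v. of_real (Re v * uxx z + Im v * uxy z)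
             - \<i> * of_real (Re v * uyx z + Im v * uyy z))) (at z)"
      unfolding G_def Complex_eq using ux[OF z] uy[OF z]
      by (auto intro!: derivative_eq_intros)
    also have "(\<lambda>v. of_real (Re v * uxx z + Im v * uxy z) - \<i> * of_real (Re v * uyx z + Im v * uyy z))
        = (*) (Complex (uxx z) (- uyx z))"
    proof -
      have "uyy z = - uxx z" using lap[OF z] by simp
      then show ?thesis by (simp add: fun_eq_iff complex_eq_iff sym[OF z])
    qed
    finally show ?thesis by (simp add: has_field_derivative_def)
  qed
  have "G holomorphic_on unit_disk"
    by (rule holomorphic_onI, rule field_differentiable_at_within)
       (auto simp: field_differentiable_def intro!: exI G)
  then obtain g0 where g0': "\<And>z. z \<in> unit_disk \<Longrightarrow> (g0 has_field_derivative G z) (at z within unit_disk)"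
    by (rule holomorphic_convex_primitive'[OF convex_ball open_ball]) (rule that)
  have g0: "(g0 has_field_derivative G z) (at z)" if "z \<in> unit_disk" for z
    using g0'[OF that] unfolding at_within_open[OF that open_ball] .
  define g where "g z = g0 z + (of_real (u 0) - g0 0)" for z
  have g: "(g has_field_derivative G z) (at z)" if "z \<in> unit_disk" for z
    unfolding g_def using g0[OF that] by (auto intro!: derivative_eq_intros)
  have "((\<lambda>z. u z - Re (g z)) has_derivative (\<lambda>v. 0)) (at z within unit_disk)" if "z \<in> unit_disk" for z
  proof -
    have "((\<lambda>z. u z - Re (g z)) has_derivative (\<lambda>v. (Re v * ux z + Im v * uy z) - Re (G z * v))) (at z)"
      using u[OF that] has_derivative_Re[OF g[OF that, unfolded has_field_derivative_def]]
      by (rule has_derivative_diff)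
    then have "((\<lambda>z. u z - Re (g z)) has_derivative (\<lambda>v. 0)) (at z)"
      by (simp add: G_def algebra_simps)
    then show ?thesis by (rule has_derivative_at_withinI)
  qed
  then have "\<exists>c. \<forall>z\<in>unit_disk. u z - Re (g z) = c"
    by (intro has_derivative_zero_constant[OF convex_ball])
  then obtain c where c: "\<And>z. z \<in> unit_disk \<Longrightarrow> u z - Re (g z) = c" by blast
  have "c = 0" using c[of 0] by (simp add: g_def)
  then have "u z = Re (g z)" if "z \<in> unit_disk" for z using c[OF that] by simp
  moreover have "g holomorphic_on unit_disk"
    by (rule holomorphic_onI, rule field_differentiable_at_within)
       (auto simp: field_differentiable_def intro!: exI g)
  moreover have "Im (g 0) = 0" by (simp add: g_def)
  ultimately show ?thesis by (metis that)
qed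

section \<open>The positive part of the logarithm\<close>

lemma log_plus_eq: "0 \<le> x \<Longrightarrow> log_plus x = ln (max 1 x)"
  by (cases "x = 0") (auto simp: log_plus_def max_def)

lemma log_plus_nonneg: "0 \<le> log_plus x"
  by (simp add: log_plus_def)

lemma log_plus_mono: "0 \<le> x \<Longrightarrow> x \<le> y \<Longrightarrow> log_plus x \<le> log_plus y"
  by (simp add: log_plus_eq)

lemma log_plus_le_iff: "0 \<le> x \<Longrightarrow> 0 \<le> t \<Longrightarrow> log_plus x \<le> t \<longleftrightarrow> x \<le> exp t"
proof -
  assume "0 \<le> x" "0 \<le> t"
  have "ln (max 1 x) \<le> ln (exp t) \<longleftrightarrow> max 1 x \<le> exp t" by (rule ln_le_cancel_iff) auto
  then show ?thesis using \<open>0 \<le> x\<close> \<open>0 \<le> t\<close> by (simp add: log_plus_eq)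
qed

lemma log_plus_le_ln: "0 \<le> x \<Longrightarrow> log_plus x \<le> ln (1 + x)"
  by (simp add: log_plus_eq)

lemma ln_le_log_plus: "0 \<le> x \<Longrightarrow> ln (1 + x) \<le> ln 2 + log_plus x"
proof -
  assume "0 \<le> x"
  have "ln (1 + x) \<le> ln (2 * max 1 x)" using \<open>0 \<le> x\<close> by (subst ln_le_cancel_iff) auto
  then show ?thesis using \<open>0 \<le> x\<close> by (auto simp: log_plus_eq ln_mult split: if_splits)
qed

lemma log_plus_power: "0 \<le> x \<Longrightarrow> log_plus (x ^ n) = n * log_plus x"
  by (cases "x \<le> 1"; cases "x = 0")
     (auto simp: log_plus_def max_def ln_realpow power_le_one zero_le_mult_iff mult_le_0_iff power_0_left)

lemma continuous_on_log_plus [continuous_intros]: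
  assumes "continuous_on S f" "\<And>x. x \<in> S \<Longrightarrow> 0 \<le> f x"
  shows "continuous_on S (\<lambda>x. log_plus (f x))"
proof -
  have "continuous_on S (\<lambda>x. ln (max 1 (f x)))"
    using assms(1) by (intro continuous_intros) (auto simp: max_def)
  then show ?thesis using assms(2) by (simp add: log_plus_eq cong: continuous_on_cong)
qed

section \<open>Circle means\<close>

definition circle_mean :: "(complex \<Rightarrow> real) \<Rightarrow> real \<Rightarrow> real"
  where "circle_mean u r = 1 / (2 * pi) * integral {0..2 * pi} (\<lambda>\<theta>. u (rcis r \<theta>))"

lemma circle_integrable:
  assumes "continuous_on (sphere 0 \<bar>r\<bar>) u"
  shows "(\<lambda>\<theta>. u (rcis r \<theta>) :: real) integrable_on {0..2 * pi}"
proof (rule integrable_continuous_real)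
  show "continuous_on {0..2 * pi} (\<lambda>\<theta>. u (rcis r \<theta>))"
    by (rule continuous_on_compose2[OF assms]) (auto simp: rcis_def norm_mult intro!: continuous_intros)
qed

lemma circle_mean_mono:
  assumes "continuous_on (sphere 0 \<bar>r\<bar>) u" "continuous_on (sphere 0 \<bar>r\<bar>) v"
    and "\<And>z. norm z = \<bar>r\<bar> \<Longrightarrow> u z \<le> v z"
  shows "circle_mean u r \<le> circle_mean v r"
  unfolding circle_mean_def
  by (intro mult_left_mono integral_le circle_integrable assms) (auto simp: )

lemma circle_mean_add_const:
  assumes "continuous_on (sphere 0 \<bar>r\<bar>) u"
  shows "circle_mean (\<lambda>z. u z + c) r = circle_mean u r + c"
  unfolding circle_mean_def
  by (subst integral_add) (use circle_integrable[OF assms] in \<open>auto simp: field_simps\<close>)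

text \<open>
  This is the mean value property, read off from the Cauchy integral formula at the centre.
\<close>
lemma circle_mean_Re:
  assumes "g holomorphic_on cball 0 r" "0 < r"
  shows "circle_mean (\<lambda>z. Re (g z)) r = Re (g 0)"
proof -
  have "((\<lambda>u. g u / (u - 0)) has_contour_integral (2 * of_real pi * \<i> * g 0)) (circlepath 0 r)"
    using assms by (intro Cauchy_integral_circlepath_simple) auto
  then have "((\<lambda>t. g (of_real r * cis t) / (of_real r * cis t) * of_real r * \<i> * cis t)
      has_integral (2 * of_real pi * \<i> * g 0)) {0..2 * pi}"
    unfolding circlepath_def by (subst (asm) has_contour_integral_part_circlepath_iff) auto
  moreover have "g (of_real r * cis t) / (of_real r * cis t) * of_real r * \<i> * cis t = \<i> * g (rcis r t)" for t
    using assms(2) by (simp add: rcis_def)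
  ultimately have "((\<lambda>t. \<i> * g (rcis r t)) has_integral (2 * of_real pi * \<i> * g 0)) {0..2 * pi}"
    by (simp only:)
  from has_integral_Im[OF this]
  have "((\<lambda>t. Re (g (rcis r t))) has_integral (2 * pi * Re (g 0))) {0..2 * pi}" by simp
  then show ?thesis by (simp add: circle_mean_def integral_unique)
qed

section \<open>Approximation on the circle by real parts of entire functions\<close>

text \<open>
  Real trigonometric polynomials, written as real parts of polynomials in \<open>z\<close> so that they come with a
  holomorphic extension.
\<close>
inductive trig_poly :: "(complex \<Rightarrow> real) \<Rightarrow> bool" where
  monom: "trig_poly (\<lambda>z. Re (c * z ^ k))"
| add: "trig_poly p \<Longrightarrow> trig_poly q \<Longrightarrow> trig_poly (\<lambda>z. p z + q z)"

text \<open>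
  The identity \<open>2 Re x Re y = Re (x y) + Re (x cnj y)\<close>, together with \<open>cnj z = 1 / z\<close> on the circle.
  Where this would produce a negative exponent, the roles of the two factors are exchanged.
\<close>
lemma trig_poly_mult_monoms:
  "\<exists>p. trig_poly p \<and> (\<forall>z\<in>sphere 0 1. Re (c * z ^ j) * Re (d * z ^ k) = p z)"
proof -
  have aux: "\<exists>p. trig_poly p \<and> (\<forall>z\<in>sphere 0 1. Re (c * z ^ j) * Re (d * z ^ k) = p z)"
    if "k \<le> j" for c d j k
  proof (intro exI conjI ballI)
    show "trig_poly (\<lambda>z. Re (c * d / 2 * z ^ (j + k)) + Re (c * cnj d / 2 * z ^ (j - k)))"
      by (intro trig_poly.intros)
    fix z :: complex assume z: "z \<in> sphere 0 1"
    have zk: "z ^ k * cnj (z ^ k) = 1"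
      unfolding complex_norm_square[symmetric] using z by (simp add: norm_power)
    have "z ^ (j - k) * z ^ k = z ^ j"
      using that by (simp flip: power_add)
    then have "z ^ j * cnj (z ^ k) = z ^ (j - k) * (z ^ k * cnj (z ^ k))"
      by (metis mult.assoc)
    also have "\<dots> = z ^ (j - k)" by (simp only: zk mult_1_right)
    finally have "z ^ j * cnj (z ^ k) = z ^ (j - k)" .
    then have *: "c * cnj d / 2 * z ^ (j - k) = (c * z ^ j) * cnj (d * z ^ k) / 2"
      by (simp add: field_simps)
    have "Re x * Re y = Re (x * y / 2) + Re (x * cnj y / 2)" for x y :: complex
      by (simp add: field_simps)
    from this[of "c * z ^ j" "d * z ^ k"]
    show "Re (c * z ^ j) * Re (d * z ^ k)
        = Re (c * d / 2 * z ^ (j + k)) + Re (c * cnj d / 2 * z ^ (j - k))"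
      unfolding * by (simp add: power_add mult_ac)
  qed
  show ?thesis
  proof (cases "k \<le> j")
    case True then show ?thesis by (rule aux)
  next
    case False then show ?thesis using aux[of j k d c] by (simp add: mult.commute)
  qed
qed

lemma trig_poly_mult:
  assumes "trig_poly p" "trig_poly q"
  shows "\<exists>s. trig_poly s \<and> (\<forall>z\<in>sphere 0 1. p z * q z = s z)"
  using assms
proof (induction p rule: trig_poly.induct)
  case (monom c j)
  then show ?case
  proof (induction q rule: trig_poly.induct)
    case (monom d k)
    show ?case by (rule trig_poly_mult_monoms)
  next
    case (add q1 q2)
    then obtain s1 s2 where "trig_poly s1" "trig_poly s2"
      "\<forall>z\<in>sphere 0 1. Re (c * z ^ j) * q1 z = s1 z" "\<forall>z\<in>sphere 0 1. Re (c * z ^ j) * q2 z = s2 z"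
      by blast
    then show ?case
      by (intro exI[of _ "\<lambda>z. s1 z + s2 z"]) (auto simp: distrib_left intro: trig_poly.add)
  qed
next
  case (add p1 p2)
  then obtain s1 s2 where "trig_poly s1" "trig_poly s2"
    "\<forall>z\<in>sphere 0 1. p1 z * q z = s1 z" "\<forall>z\<in>sphere 0 1. p2 z * q z = s2 z" by blast
  then show ?case
    by (intro exI[of _ "\<lambda>z. s1 z + s2 z"]) (auto simp: distrib_right intro: trig_poly.add)
qed

text \<open>
  A real linear form on the plane is \<open>z \<mapsto> Re (c z)\<close>, and trigonometric polynomials are closed under
  sums and, on the circle, under products.
\<close>
lemma real_polynomial_eq_trig_poly_on_circle:
  fixes p :: "complex \<Rightarrow> real"
  assumes "real_polynomial_function p"
  shows "\<exists>s. trig_poly s \<and> (\<forall>z\<in>sphere 0 1. p z = s z)"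
  using assms
proof (induction p rule: real_polynomial_function.induct)
  case (linear l)
  have eq: "l z = Re (Complex (l 1) (- l \<i>) * z ^ 1)" for z
  proof -
    interpret bounded_linear l by fact
    have "z = Re z *\<^sub>R 1 + Im z *\<^sub>R \<i>" by (simp add: complex_eq_iff)
    then have "l z = l (Re z *\<^sub>R 1 + Im z *\<^sub>R \<i>)" by (rule arg_cong)
    also have "\<dots> = Re z * l 1 + Im z * l \<i>" by (simp only: add scale real_scaleR_def)
    finally show ?thesis by simp
  qed
  show ?case
    by (rule exI, rule conjI[OF trig_poly.monom], rule ballI, rule eq)
next
  case (const c)
  show ?case using trig_poly.monom[of "of_real c" 0] by auto
next
  case (add p q)
  then obtain s1 s2 where "trig_poly s1" "trig_poly s2"
    "\<forall>z\<in>sphere 0 1. p z = s1 z" "\<forall>z\<in>sphere 0 1. q z = s2 z" by blast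
  then show ?case
    by (intro exI[of _ "\<lambda>z. s1 z + s2 z"]) (auto intro: trig_poly.add)
next
  case (mult p q)
  then obtain s1 s2 where s: "trig_poly s1" "trig_poly s2"
    "\<forall>z\<in>sphere 0 1. p z = s1 z" "\<forall>z\<in>sphere 0 1. q z = s2 z" by blast
  from trig_poly_mult[OF s(1,2)] s(3,4) show ?case by auto
qed

lemma trig_poly_eq_Re_entire:
  assumes "trig_poly p"
  shows "\<exists>q. q holomorphic_on UNIV \<and> (\<forall>z. p z = Re (q z))"
  using assms
proof (induction p rule: trig_poly.induct)
  case (monom c k)
  show ?case by (intro exI[of _ "\<lambda>z. c * z ^ k"]) (auto intro!: holomorphic_intros)
next
  case (add p1 p2)
  then obtain q1 q2 where "q1 holomorphic_on UNIV" "q2 holomorphic_on UNIV"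
    "\<forall>z. p1 z = Re (q1 z)" "\<forall>z. p2 z = Re (q2 z)" by blast
  then show ?case
    by (intro exI[of _ "\<lambda>z. q1 z + q2 z"]) (simp add: holomorphic_on_add)
qed

text \<open>
  This replaces the solution of the Dirichlet problem: the boundary values are met only approximately,
  but the harmonic function is the real part of an entire function, up to the boundary and beyond.
\<close>
lemma entire_approx_on_circle:
  fixes u :: "complex \<Rightarrow> real"
  assumes "continuous_on (sphere 0 1) u" "0 < \<epsilon>"
  obtains q where "q holomorphic_on UNIV" "Im (q 0) = 0"
    "\<And>z. norm z = 1 \<Longrightarrow> \<bar>u z - Re (q z)\<bar> < \<epsilon>"
proof -
  obtain p where p: "real_polynomial_function p" "\<And>z. z \<in> sphere 0 1 \<Longrightarrow> \<bar>u z - p z\<bar> < \<epsilon>"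
    using Stone_Weierstrass_real_polynomial_function[OF compact_sphere assms] by blast
  obtain s where s: "trig_poly s" "\<forall>z\<in>sphere 0 1. p z = s z"
    using real_polynomial_eq_trig_poly_on_circle[OF p(1)] by blast
  obtain q where q: "q holomorphic_on UNIV" "\<forall>z. s z = Re (q z)"
    using trig_poly_eq_Re_entire[OF s(1)] by blast
  show ?thesis
  \<comment> \<open>An imaginary constant does not change the real part and makes the value at \<open>0\<close> real.\<close>
  proof (rule that[of "\<lambda>z. q z - \<i> * of_real (Im (q 0))"])
    show "(\<lambda>z. q z - \<i> * complex_of_real (Im (q 0))) holomorphic_on UNIV"
      using q(1) by (intro holomorphic_on_diff holomorphic_on_const)
  qed (use p(2) s(2) q(2) in auto)
qed

section \<open>Entire majorants on smaller disks\<close>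

text \<open>
  On the unit circle \<open>Re q\<close> is chosen between \<open>log\<^sup>+ |f(rz)|\<close> and \<open>log\<^sup>+ |f(rz)| + \<epsilon>\<close>. So \<open>exp (-q)\<close>
  and \<open>f(rz) exp (-q(z))\<close> have modulus at most \<open>1\<close> there, hence in the disk: the first bound says
  \<open>0 \<le> Re q\<close>, the second \<open>log |f(rz)| \<le> Re q(z)\<close>. The value \<open>Re q(0)\<close> is the mean of \<open>Re q\<close> on the circle.
\<close>
lemma entire_majorant:
  assumes f: "f holomorphic_on unit_disk" and r: "0 < r" "r < 1" and "0 < \<epsilon>"
  obtains q where "q holomorphic_on UNIV" "Im (q 0) = 0"
    "\<And>z. norm z \<le> 1 \<Longrightarrow> log_plus (norm (f (of_real r * z))) \<le> Re (q z)"
    "Re (q 0) \<le> circle_mean (\<lambda>z. log_plus (norm (f z))) r + \<epsilon>"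
proof -
  define F where "F z = f (of_real r * z)" for z
  have img: "(\<lambda>z. complex_of_real r * z) ` cball 0 1 \<subseteq> unit_disk"
  proof clarsimp
    fix z :: complex assume "norm z \<le> 1"
    then have "r * norm z \<le> r * 1" using r by (intro mult_left_mono) auto
    then have "r * norm z < 1" using r(2) by linarith
    then show "norm (complex_of_real r * z) < 1" using r by (simp add: norm_mult)
  qed
  have F: "F holomorphic_on cball 0 1"
    using holomorphic_on_compose_gen[OF _ f img, unfolded o_def]
    unfolding F_def by (auto intro!: holomorphic_intros)
  have cF: "continuous_on (sphere 0 1) (\<lambda>z. log_plus (norm (F z)))"
    using F by (intro continuous_intros holomorphic_on_imp_continuous_on)
      (auto intro: holomorphic_on_subset)
  obtain q0 where q0: "q0 holomorphic_on UNIV" "Im (q0 0) = 0"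
    "\<And>z. norm z = 1 \<Longrightarrow> \<bar>log_plus (norm (F z)) - Re (q0 z)\<bar> < \<epsilon> / 2"
    using entire_approx_on_circle[OF cF, of "\<epsilon> / 2"] \<open>0 < \<epsilon>\<close> by auto
  \<comment> \<open>The shift by half the tolerance turns the two-sided approximation into an upper bound.\<close>
  define q where "q z = q0 z + of_real (\<epsilon> / 2)" for z
  have q: "q holomorphic_on UNIV" unfolding q_def using q0(1) by (intro holomorphic_on_add holomorphic_on_const)
  have circ: "log_plus (norm (F z)) \<le> Re (q z)" "Re (q z) \<le> log_plus (norm (F z)) + \<epsilon>"
    if "norm z = 1" for z
    using q0(3)[OF that] by (auto simp: q_def abs_if split: if_splits)
  have le1: "norm (k z) \<le> 1"
    if "k holomorphic_on cball 0 1" "\<And>z. norm z = 1 \<Longrightarrow> norm (k z) \<le> 1" "norm z \<le> 1"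
    for k :: "complex \<Rightarrow> complex" and z
    by (rule maximum_modulus_frontier[of k "cball 0 1"])
       (use that in \<open>auto intro: holomorphic_on_subset holomorphic_on_imp_continuous_on\<close>)
  have maj: "log_plus (norm (F z)) \<le> Re (q z)" if z: "norm z \<le> 1" for z
  proof -
    have "norm (exp (- q z)) \<le> 1"
    proof (rule le1[OF _ _ z])
      show "(\<lambda>z. exp (- q z)) holomorphic_on cball 0 1"
        using holomorphic_on_subset[OF q] by (intro holomorphic_intros) auto
      show "norm (exp (- q z)) \<le> 1" if "norm z = 1" for z
        using order_trans[OF log_plus_nonneg circ(1)[OF that]] by simp
    qed
    then have 1: "0 \<le> Re (q z)" by simp
    have "norm (F z * exp (- q z)) \<le> 1"
    proof (rule le1[OF _ _ z])
      show "(\<lambda>z. F z * exp (- q z)) holomorphic_on cball 0 1"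
        using F holomorphic_on_subset[OF q] by (intro holomorphic_intros) auto
      show "norm (F z * exp (- q z)) \<le> 1" if "norm z = 1" for z
        using circ(1)[OF that] order_trans[OF log_plus_nonneg circ(1)[OF that]]
        by (simp add: log_plus_le_iff norm_mult norm_divide exp_minus field_simps)
    qed
    then show ?thesis
      using 1 by (simp add: log_plus_le_iff norm_mult norm_divide exp_minus field_simps)
  qed
  have "Re (q 0) = circle_mean (\<lambda>z. Re (q z)) 1"
    using circle_mean_Re[of q 1] holomorphic_on_subset[OF q] by simp
  also have "\<dots> \<le> circle_mean (\<lambda>z. log_plus (norm (F z)) + \<epsilon>) 1"
    using cF holomorphic_on_imp_continuous_on[OF holomorphic_on_subset[OF q subset_UNIV]] circ(2)
    by (intro circle_mean_mono continuous_on_add continuous_on_Re continuous_on_const) auto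
  also have "\<dots> = circle_mean (\<lambda>z. log_plus (norm (F z))) 1 + \<epsilon>"
    using cF by (intro circle_mean_add_const) auto
  also have "circle_mean (\<lambda>z. log_plus (norm (F z))) 1 = circle_mean (\<lambda>z. log_plus (norm (f z))) r"
    by (simp add: circle_mean_def F_def rcis_def)
  finally show ?thesis
    using q maj q0(2) by (intro that[of q]) (auto simp: q_def F_def)
qed

section \<open>Functions with non-negative real part and Harnack's inequality\<close>

text \<open>
  The Schwarz lemma for \<open>w = (g - g(0)) / (g + g(0))\<close>, the composition of \<open>g\<close> with the Cayley map of the
  right half-plane that sends \<open>g(0)\<close> to the origin.
\<close>
lemma half_plane_Schwarz_strict:
  assumes g: "g holomorphic_on unit_disk" and pos: "\<And>z. z \<in> unit_disk \<Longrightarrow> 0 < Re (g z)"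
    and "Im (g 0) = 0" and z: "z \<in> unit_disk"
  shows "norm (g z) * (1 - norm z) \<le> Re (g 0) * (1 + norm z)"
proof -
  define a where "a = Re (g 0)"
  have a: "0 < a" using pos[of 0] by (simp add: a_def)
  have g0: "g 0 = of_real a" using assms(3) by (simp add: a_def complex_eq_iff)
  define w where "w z = (g z - of_real a) / (g z + of_real a)" for z
  have nz: "g z + of_real a \<noteq> 0" if "z \<in> unit_disk" for z
  proof
    assume "g z + of_real a = 0"
    then have "Re (g z) + a = 0" by (metis Re_complex_of_real plus_complex.sel(1) zero_complex.sel(1))
    then show False using pos[OF that] a by simp
  qed
  have w1: "norm (w z) < 1" if "z \<in> unit_disk" for z
  proof -
    have "(norm (g z - of_real a))\<^sup>2 < (norm (g z + of_real a))\<^sup>2"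
      using pos[OF that] a by (simp only: cmod_power2 minus_complex.sel plus_complex.sel Re_complex_of_real Im_complex_of_real) (simp add: power2_eq_square algebra_simps)
    then have "norm (g z - of_real a) < norm (g z + of_real a)"
      by (rule power_less_imp_less_base) simp
    then show ?thesis using nz[OF that] by (simp add: w_def norm_divide)
  qed
  have "w holomorphic_on unit_disk"
    unfolding w_def using g nz
    by (intro holomorphic_on_divide holomorphic_on_add holomorphic_on_diff holomorphic_on_const) auto
  then have wz: "norm (w z) \<le> norm z"
    by (rule Schwarz_Lemma(1)) (use w1 z in \<open>auto simp: w_def g0\<close>)
  have eq: "g z * (1 - w z) = of_real a * (1 + w z)"
    using nz[OF z] by (simp add: w_def field_simps)
  have "norm (g z) * (1 - norm z) \<le> norm (g z) * norm (1 - w z)"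
    using norm_triangle_ineq2[of 1 "w z"] wz by (intro mult_left_mono) auto
  also have "\<dots> = norm (of_real a * (1 + w z))" by (simp flip: eq norm_mult)
  also have "\<dots> \<le> a * (1 + norm z)"
    using a norm_triangle_ineq[of 1 "w z"] wz unfolding norm_mult
    by (intro mult_mono) auto
  finally show ?thesis by (simp add: a_def)
qed

text \<open>
  The Cayley map degenerates when \<open>g(0) = 0\<close>; adding a small positive constant reduces this to the
  strict case.
\<close>
lemma half_plane_Schwarz:
  assumes g: "g holomorphic_on unit_disk" and pos: "\<And>z. z \<in> unit_disk \<Longrightarrow> 0 \<le> Re (g z)"
    and "Im (g 0) = 0" and z: "z \<in> unit_disk"
  shows "norm (g z) * (1 - norm z) \<le> Re (g 0) * (1 + norm z)"
proof (rule field_le_epsilon)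
  fix e :: real assume "0 < e"
  define d where "d = e / 3"
  have d: "0 < d" "e = 3 * d" using \<open>0 < e\<close> by (auto simp: d_def)
  have nz: "0 \<le> norm z" "norm z < 1" using z by auto
  have "norm (g z + of_real d) * (1 - norm z) \<le> Re (g 0 + of_real d) * (1 + norm z)"
  proof (rule half_plane_Schwarz_strict[OF _ _ _ z])
    show "(\<lambda>z. g z + of_real d) holomorphic_on unit_disk"
      using g by (intro holomorphic_on_add holomorphic_on_const)
    show "0 < Re (g z + of_real d)" if "z \<in> unit_disk" for z using pos[OF that] d(1) by simp
  qed (use assms(3) in simp)
  moreover have "norm (g z) \<le> norm (g z + of_real d) + d"
    using norm_triangle_ineq4[of "g z + of_real d" "of_real d"] d(1) by simp
  then have "norm (g z) * (1 - norm z) \<le> (norm (g z + of_real d) + d) * (1 - norm z)"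
    using nz by (intro mult_right_mono) auto
  moreover have "d * norm z \<le> d" using d nz by simp
  moreover have "0 \<le> d * norm z" using d nz by simp
  ultimately show "norm (g z) * (1 - norm z) \<le> Re (g 0) * (1 + norm z) + e"
    unfolding d(2) plus_complex.sel Re_complex_of_real by (simp add: distrib_left distrib_right right_diff_distrib)
qed

text \<open>
  The normalisation \<open>Im g(0) = 0\<close> is what the bound on \<open>g\<close> by \<open>g(0)\<close> above asks for.
\<close>
lemma Har_plus_eq_Re:
  assumes "h \<in> Har_plus"
  obtains g where "g holomorphic_on unit_disk" "Im (g 0) = 0"
    "\<And>z. z \<in> unit_disk \<Longrightarrow> h z = Re (g z)" "\<And>z. z \<in> unit_disk \<Longrightarrow> 0 \<le> Re (g z)"
proof -
  have h: "h harmonic_on unit_disk" "\<And>z. z \<in> unit_disk \<Longrightarrow> 0 \<le> h z"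
    using assms by (auto simp: Har_plus_def)
  obtain g where g: "g holomorphic_on unit_disk" "Im (g 0) = 0" "\<And>z. z \<in> unit_disk \<Longrightarrow> h z = Re (g z)"
    by (rule harmonic_on_disk_eq_Re[OF h(1)]) (rule that)
  show ?thesis
    by (rule that[OF g]) (use h(2) g(3) in \<open>force+\<close>)
qed

lemma Re_in_Har_plus:
  assumes "g holomorphic_on unit_disk" "\<And>z. z \<in> unit_disk \<Longrightarrow> 0 \<le> Re (g z)"
  shows "(\<lambda>z. Re (g z)) \<in> Har_plus"
  using harmonic_on_Re[OF assms(1) open_ball] assms(2) by (simp add: Har_plus_def)

lemma const_in_Har_plus: "0 \<le> c \<Longrightarrow> (\<lambda>z. c) \<in> Har_plus"
  using Re_in_Har_plus[of "\<lambda>z. of_real c"] by (simp add: holomorphic_on_const)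

lemma affine_in_Har_plus:
  assumes "h \<in> Har_plus" "0 \<le> a" "0 \<le> b"
  shows "\<exists>k\<in>Har_plus. \<forall>z\<in>unit_disk. k z = a + b * h z"
proof -
  obtain g where g: "g holomorphic_on unit_disk" "Im (g 0) = 0"
    "\<And>z. z \<in> unit_disk \<Longrightarrow> h z = Re (g z)" "\<And>z. z \<in> unit_disk \<Longrightarrow> 0 \<le> Re (g z)"
    by (rule Har_plus_eq_Re[OF assms(1)]) (rule that)
  have "(\<lambda>z. Re (of_real a + of_real b * g z)) \<in> Har_plus"
    using g(1) g(4) assms(2,3)
    by (intro Re_in_Har_plus holomorphic_on_add holomorphic_on_mult holomorphic_on_const) auto
  then show ?thesis by (rule bexI[rotated]) (simp add: g(3))
qed

lemma Harnack_inequality: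
  assumes "h \<in> Har_plus" "z \<in> unit_disk"
  shows "h z * (1 - norm z) \<le> h 0 * (1 + norm z)"
proof -
  obtain g where g: "g holomorphic_on unit_disk" "Im (g 0) = 0"
    "\<And>z. z \<in> unit_disk \<Longrightarrow> h z = Re (g z)" "\<And>z. z \<in> unit_disk \<Longrightarrow> 0 \<le> Re (g z)"
    by (rule Har_plus_eq_Re[OF assms(1)]) (rule that)
  have "h z * (1 - norm z) \<le> norm (g z) * (1 - norm z)"
    using assms(2) complex_Re_le_cmod[of "g z"] by (intro mult_right_mono) (auto simp: g(3))
  also have "\<dots> \<le> h 0 * (1 + norm z)"
    using half_plane_Schwarz[OF g(1,4,2) assms(2)] by (simp add: g(3))
  finally show ?thesis .
qed

section \<open>The Nevanlinna class and harmonic majorants\<close>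

abbreviation log_mean :: "(complex \<Rightarrow> complex) \<Rightarrow> real \<Rightarrow> real"
  where "log_mean f \<equiv> circle_mean (\<lambda>z. log_plus (norm (f z)))"

lemma Nevanlinna_iff_log_mean:
  "f \<in> Nevanlinna \<longleftrightarrow> f holomorphic_on unit_disk \<and> (\<exists>L. (log_mean f \<longlongrightarrow> L) (at_left 1))"
  by (simp add: Nevanlinna_def circle_mean_def[abs_def])

lemma log_mean_le_Re:
  assumes f: "f holomorphic_on unit_disk" and g: "g holomorphic_on cball 0 r"
    and le: "\<And>z. norm z = r \<Longrightarrow> log_plus (norm (f z)) \<le> Re (g z)" and r: "0 < r" "r < 1"
  shows "log_mean f r \<le> Re (g 0)"
proof -
  have "sphere 0 r \<subseteq> unit_disk" "sphere 0 r \<subseteq> cball (0::complex) r"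
    using r by auto
  then have "continuous_on (sphere 0 r) f" "continuous_on (sphere 0 r) g"
    using holomorphic_on_subset[OF f] holomorphic_on_subset[OF g]
    by (blast intro: holomorphic_on_imp_continuous_on)+
  then have "log_mean f r \<le> circle_mean (\<lambda>z. Re (g z)) r"
    using le r by (intro circle_mean_mono continuous_on_log_plus continuous_on_norm continuous_on_Re) auto
  then show ?thesis using circle_mean_Re[OF g r(1)] by simp
qed

text \<open>
  The entire function \<open>q(z / s)\<close> majorizes \<open>log\<^sup>+ |f|\<close> on the disk of radius \<open>s\<close>; its mean is the same on
  the circles of radius \<open>r\<close> and \<open>s\<close>, and on the larger one it almost equals that of \<open>log\<^sup>+ |f|\<close>.
\<close>
lemma log_mean_mono:
  assumes f: "f holomorphic_on unit_disk" and rs: "0 < r" "r \<le> s" "s < 1"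
  shows "log_mean f r \<le> log_mean f s"
proof (rule field_le_epsilon)
  fix e :: real assume e: "0 < e"
  have s: "0 < s" using rs by simp
  obtain q where q: "q holomorphic_on UNIV" "Im (q 0) = 0"
    "\<And>z. norm z \<le> 1 \<Longrightarrow> log_plus (norm (f (of_real s * z))) \<le> Re (q z)"
    "Re (q 0) \<le> log_mean f s + e"
    by (rule entire_majorant[OF f s rs(3) e]) (rule that)
  have "log_mean f r \<le> Re (q (0 / of_real s))"
  proof (rule log_mean_le_Re[OF f])
    have "(\<lambda>z. z / complex_of_real s) holomorphic_on cball 0 r"
      using s by (intro holomorphic_intros) auto
    from holomorphic_on_compose_gen[OF this q(1)]
    show "(\<lambda>z. q (z / of_real s)) holomorphic_on cball 0 r" by (simp add: o_def)
    fix z :: complex assume "norm z = r"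
    then have "norm (z / of_real s) \<le> 1" using rs by (simp add: norm_divide)
    from q(3)[OF this] show "log_plus (norm (f z)) \<le> Re (q (z / of_real s))" using s by simp
  qed (use rs in auto)
  then show "log_mean f r \<le> log_mean f s + e" using q(4) by simp
qed

lemma Nevanlinna_log_mean_bounded:
  assumes "f \<in> Nevanlinna"
  obtains L where "\<And>r. 0 < r \<Longrightarrow> r < 1 \<Longrightarrow> log_mean f r \<le> L"
proof -
  obtain L where f: "f holomorphic_on unit_disk" and L: "(log_mean f \<longlongrightarrow> L) (at_left 1)"
    using assms unfolding Nevanlinna_iff_log_mean by blast
  show ?thesis
  proof (rule that)
    fix r :: real assume r: "0 < r" "r < 1"
    have "\<forall>\<^sub>F s in at_left 1. s \<in> {r<..<1}"
      using r(2) by (intro eventually_at_leftI[of r]) auto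
    then have "\<forall>\<^sub>F s in at_left 1. log_mean f r \<le> log_mean f s"
      by (rule eventually_mono) (use r in \<open>auto intro!: log_mean_mono[OF f]\<close>)
    then show "log_mean f r \<le> L" by (intro tendsto_lowerbound[OF L]) auto
  qed
qed

text \<open>
  The circle means are increasing in the radius and bounded by the value of the majorant at the
  origin, so that their limit is their supremum.
\<close>
lemma Nevanlinna_if_majorant:
  assumes f: "f holomorphic_on unit_disk" and h: "h \<in> Har_plus"
    and le: "\<And>z. z \<in> unit_disk \<Longrightarrow> log_plus (norm (f z)) \<le> h z"
  shows "f \<in> Nevanlinna"
proof -
  obtain g where g: "g holomorphic_on unit_disk" "Im (g 0) = 0"
    "\<And>z. z \<in> unit_disk \<Longrightarrow> h z = Re (g z)" "\<And>z. z \<in> unit_disk \<Longrightarrow> 0 \<le> Re (g z)"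
    by (rule Har_plus_eq_Re[OF h]) (rule that)
  have bd: "log_mean f r \<le> Re (g 0)" if "0 < r" "r < 1" for r
  proof (rule log_mean_le_Re[OF f holomorphic_on_subset[OF g(1)] _ that])
    show "cball 0 r \<subseteq> unit_disk" using that by auto
    show "log_plus (norm (f z)) \<le> Re (g z)" if "norm z = r" for z
      using le[of z] g(3)[of z] that \<open>r < 1\<close> by simp
  qed
  define L where "L = (SUP r\<in>{0<..<1}. log_mean f r)"
  have bdd: "bdd_above (log_mean f ` {0<..<1})"
    using bd by (intro bdd_aboveI2[of _ _ "Re (g 0)"]) auto
  have "(log_mean f \<longlongrightarrow> L) (at_left 1)"
  proof (rule order_tendstoI)
    fix a assume "a < L"
    then obtain r where "r \<in> {0<..<1}" "a < log_mean f r"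
      unfolding L_def by (subst (asm) less_cSUP_iff[OF _ bdd]) auto
    then have r: "0 < r" "r < 1" "a < log_mean f r" by auto
    have "\<forall>\<^sub>F s in at_left 1. s \<in> {r<..<1}"
      using r(2) by (intro eventually_at_leftI[of r]) auto
    then show "\<forall>\<^sub>F s in at_left 1. a < log_mean f s"
      by (rule eventually_mono)
        (use r in \<open>auto intro!: less_le_trans[OF r(3)] log_mean_mono[OF f]\<close>)
  next
    fix a assume "L < a"
    have "\<forall>\<^sub>F s in at_left 1. s \<in> {0<..<1::real}"
      by (rule eventually_at_leftI[of 0]) auto
    then show "\<forall>\<^sub>F s in at_left 1. log_mean f s < a"
    proof (rule eventually_mono)
      fix s :: real assume "s \<in> {0<..<1}"
      then have "log_mean f s \<le> L" unfolding L_def by (rule cSUP_upper[OF _ bdd])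
      then show "log_mean f s < a" using \<open>L < a\<close> by simp
    qed
  qed
  then show ?thesis using f unfolding Nevanlinna_iff_log_mean by blast
qed

text \<open>
  The entire majorants for radii \<open>s\<^sub>n\<close> tending to \<open>1\<close> have non-negative real parts and bounded values at
  the origin. They are therefore locally bounded, and a locally uniform limit of a subsequence has
  the required real part.
\<close>
lemma Nevanlinna_has_majorant:
  assumes "f \<in> Nevanlinna"
  obtains h where "h \<in> Har_plus" "\<And>z. z \<in> unit_disk \<Longrightarrow> log_plus (norm (f z)) \<le> h z"
proof -
  have f: "f holomorphic_on unit_disk" using assms by (simp add: Nevanlinna_def)
  obtain L where L: "\<And>r. 0 < r \<Longrightarrow> r < 1 \<Longrightarrow> log_mean f r \<le> L"
    by (rule Nevanlinna_log_mean_bounded[OF assms]) (rule that)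
  define s :: "nat \<Rightarrow> real" where "s n = 1 - inverse (real (Suc (Suc n)))" for n
  have s: "0 < s n" "s n < 1" for n
    by (auto simp: s_def field_simps)
  have s_lim: "s \<longlonglongrightarrow> 1"
    unfolding s_def
    using tendsto_diff[OF tendsto_const[of 1] LIMSEQ_Suc[OF LIMSEQ_inverse_real_of_nat]] by simp
  define P where "P n q \<longleftrightarrow> q holomorphic_on UNIV \<and> Im (q 0) = 0 \<and> Re (q 0) \<le> L + 1 \<and>
      (\<forall>z. norm z \<le> 1 \<longrightarrow> log_plus (norm (f (of_real (s n) * z))) \<le> Re (q z))" for n q
  have "\<exists>q. P n q" for n
    unfolding P_def
    by (rule entire_majorant[OF f s(1)[of n] s(2)[of n], of 1]) (use L[OF s(1,2)[of n]] in force)+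
  then obtain q where Pq: "\<forall>n. P n (q n)"
    using choice[of P] by blast
  have q: "q n holomorphic_on UNIV" "Im (q n 0) = 0" "Re (q n 0) \<le> L + 1"
    "norm z \<le> 1 \<Longrightarrow> log_plus (norm (f (of_real (s n) * z))) \<le> Re (q n z)" for n z
    using Pq[rule_format, of n] by (simp_all add: P_def)
  have qD: "q n holomorphic_on unit_disk" for n
    using holomorphic_on_subset[OF q(1)] by blast
  have q_pos: "0 \<le> Re (q n z)" if "z \<in> unit_disk" for n z
    using order_trans[OF log_plus_nonneg q(4)[of z n]] that by simp
  have q_bd: "norm (q n z) \<le> (L + 1) * (1 + norm z) / (1 - norm z)" if "z \<in> unit_disk" for n z
  proof -
    have "norm (q n z) * (1 - norm z) \<le> Re (q n 0) * (1 + norm z)"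
      by (rule half_plane_Schwarz[OF qD q_pos q(2) that])
    also have "\<dots> \<le> (L + 1) * (1 + norm z)"
      by (intro mult_right_mono q(3)) (auto intro: add_nonneg_nonneg)
    finally show ?thesis using that by (simp add: field_simps)
  qed
  have loc_bd: "\<exists>B. \<forall>h\<in>range q. \<forall>z\<in>K. norm (h z) \<le> B"
    if K: "compact K" "K \<subseteq> unit_disk" for K
  proof -
    define \<phi> :: "complex \<Rightarrow> real" where "\<phi> z = (L + 1) * (1 + norm z) / (1 - norm z)" for z
    have "continuous_on K \<phi>"
      unfolding \<phi>_def using K(2) by (intro continuous_intros) auto
    then have "bdd_above (\<phi> ` K)"
      by (intro bounded_imp_bdd_above compact_imp_bounded compact_continuous_image K(1))
    then obtain B where B: "\<forall>x\<in>\<phi> ` K. x \<le> B" unfolding bdd_above_def by blast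
    have "norm (q n z) \<le> B" if "z \<in> K" for n z
    proof -
      have "norm (q n z) \<le> \<phi> z" unfolding \<phi>_def by (rule q_bd) (use that K(2) in blast)
      also have "\<phi> z \<le> B" using B that by blast
      finally show ?thesis .
    qed
    then show ?thesis by blast
  qed
  have holq: "h holomorphic_on unit_disk" if "h \<in> range q" for h
    using that qD by blast
  obtain g k where g: "g holomorphic_on unit_disk" "strict_mono (k :: nat \<Rightarrow> nat)"
    "\<And>z. z \<in> unit_disk \<Longrightarrow> (\<lambda>n. q (k n) z) \<longlonglongrightarrow> g z"
    by (rule Montel[OF open_ball holq loc_bd subset_refl]) (assumption | rule that)+
  have maj: "log_plus (norm (f z)) \<le> Re (g z)" if z: "z \<in> unit_disk" for z
  proof (rule LIMSEQ_le)
    show "(\<lambda>n. Re (q (k n) z)) \<longlonglongrightarrow> Re (g z)"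
      by (rule tendsto_Re[OF g(3)[OF z]])
    show "\<exists>N. \<forall>n\<ge>N. log_plus (norm (f (of_real (s (k n)) * z))) \<le> Re (q (k n) z)"
      using q(4)[of z] z by auto
    have "(\<lambda>n. s (k n)) \<longlonglongrightarrow> 1"
      using LIMSEQ_subseq_LIMSEQ[OF s_lim g(2)] by (simp add: o_def)
    from tendsto_mult[OF tendsto_of_real[OF this] tendsto_const[of z]]
    have "(\<lambda>n. of_real (s (k n)) * z) \<longlonglongrightarrow> z" by simp
    moreover have "isCont (\<lambda>z. log_plus (norm (f z))) z"
    proof -
      have "continuous_on unit_disk (\<lambda>z. log_plus (norm (f z)))"
        by (intro continuous_on_log_plus continuous_on_norm holomorphic_on_imp_continuous_on f) simp
      then show ?thesis using z continuous_on_eq_continuous_at[OF open_ball] by blast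
    qed
    ultimately show "(\<lambda>n. log_plus (norm (f (of_real (s (k n)) * z)))) \<longlonglongrightarrow> log_plus (norm (f z))"
      by (rule isCont_tendsto_compose[rotated])
  qed
  have "(\<lambda>z. Re (g z)) \<in> Har_plus"
    by (rule Re_in_Har_plus[OF g(1)]) (rule order_trans[OF log_plus_nonneg maj])
  then show ?thesis by (rule that) (rule maj)
qed

section \<open>Propagation of the unit bound\<close>

text \<open>
  The property through which the three notions are compared: they all say that \<open>\<Lambda>\<close> controls the
  functions of the class, and here the control is normalised to the bound \<open>1\<close>.
\<close>
definition propagates_unit_bound :: "complex set \<Rightarrow> bool"
  where "propagates_unit_bound \<Lambda> \<longleftrightarrow>
    (\<forall>f\<in>Nevanlinna. (\<forall>w\<in>\<Lambda>. norm (f w) \<le> 1) \<longrightarrow> (\<forall>z\<in>unit_disk. norm (f z) \<le> 1))"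

lemma Nevanlinna_holomorphic: "f \<in> Nevanlinna \<Longrightarrow> f holomorphic_on unit_disk"
  by (simp add: Nevanlinna_def)

lemma Nev_N_on_le:
  assumes "h \<in> Har_plus" "\<And>w. w \<in> \<Lambda> \<Longrightarrow> ln (1 + norm (f w)) \<le> h w"
  shows "Nev_N_on f \<Lambda> \<le> h 0"
  unfolding Nev_N_on_def
proof (rule cInf_lower)
  show "bdd_below {h 0 |h. h \<in> Har_plus \<and> (\<forall>w\<in>\<Lambda>. ln (1 + norm (f w)) \<le> h w)}"
    by (rule bdd_belowI[of _ 0]) (auto simp: Har_plus_def)
qed (use assms in blast)

lemma Nev_N_le:
  assumes "h \<in> Har_plus" "\<And>w. w \<in> unit_disk \<Longrightarrow> ln (1 + norm (f w)) \<le> h w"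
  shows "Nev_N f \<le> h 0"
  using Nev_N_on_le[of h unit_disk f, OF assms] unfolding Nev_N_def Nev_N_on_def .

text \<open>
  The majorant \<open>ln 2 + n h\<close>, where \<open>h\<close> is one for \<open>log\<^sup>+ |f|\<close>, shows that the infimum \<open>N(f\<^sup>n)\<close> is taken over
  a non-empty set.
\<close>
lemma Nevanlinna_power_majorant:
  assumes "f \<in> Nevanlinna"
  obtains k where "k \<in> Har_plus" "\<And>z. z \<in> unit_disk \<Longrightarrow> ln (1 + norm (f z ^ n)) \<le> k z"
    "(\<lambda>z. f z ^ n) \<in> Nevanlinna"
proof -
  obtain h where h: "h \<in> Har_plus" "\<And>z. z \<in> unit_disk \<Longrightarrow> log_plus (norm (f z)) \<le> h z"
    by (rule Nevanlinna_has_majorant[OF assms]) (rule that)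
  obtain k where k: "k \<in> Har_plus" "\<And>z. z \<in> unit_disk \<Longrightarrow> k z = ln 2 + real n * h z"
    using affine_in_Har_plus[OF h(1), of "ln 2" "real n"] by auto
  have le: "ln (1 + norm (f z ^ n)) \<le> k z" if "z \<in> unit_disk" for z
  proof -
    have "ln (1 + norm (f z ^ n)) \<le> ln 2 + log_plus (norm (f z ^ n))"
      by (rule ln_le_log_plus) simp
    also have "\<dots> = ln 2 + n * log_plus (norm (f z))"
      by (simp add: norm_power log_plus_power)
    also have "\<dots> \<le> k z"
      unfolding k(2)[OF that] by (intro add_left_mono mult_left_mono h(2) that) auto
    finally show ?thesis .
  qed
  have N: "(\<lambda>z. f z ^ n) \<in> Nevanlinna"
  proof (rule Nevanlinna_if_majorant[OF _ k(1)])
    show "(\<lambda>z. f z ^ n) holomorphic_on unit_disk"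
      by (rule holomorphic_on_power[OF Nevanlinna_holomorphic[OF assms]])
    show "log_plus (norm (f z ^ n)) \<le> k z" if "z \<in> unit_disk" for z
      by (rule order_trans[OF log_plus_le_ln le[OF that]]) simp
  qed
  show ?thesis by (rule that[OF k(1) _ N]) (rule le)
qed

text \<open>
  The bound \<open>ln 2 + C\<close> on \<open>N(f\<^sup>n)\<close> is the same for all \<open>n\<close>, whereas \<open>log\<^sup>+ |f|\<^sup>n\<close> grows linearly in \<open>n\<close>
  wherever \<open>|f| > 1\<close>.
\<close>
lemma sampling_imp_propagates_unit_bound:
  assumes "sampling_set \<Lambda>"
  shows "propagates_unit_bound \<Lambda>"
  unfolding propagates_unit_bound_def
proof (intro ballI impI)
  fix f z assume f: "f \<in> Nevanlinna" and le1: "\<forall>w\<in>\<Lambda>. norm (f w) \<le> 1" and z: "z \<in> unit_disk"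
  obtain C where C: "\<And>g. g \<in> Nevanlinna \<Longrightarrow> Nev_N g \<le> Nev_N_on g \<Lambda> + C"
    using assms unfolding sampling_set_def by blast
  define B where "B = (ln 2 + C + 1) * (1 + norm z) / (1 - norm z)"
  have bound: "real n * log_plus (norm (f z)) \<le> B" for n
  proof -
    obtain k where k: "k \<in> Har_plus" "\<And>z. z \<in> unit_disk \<Longrightarrow> ln (1 + norm (f z ^ n)) \<le> k z"
      "(\<lambda>z. f z ^ n) \<in> Nevanlinna"
      by (rule Nevanlinna_power_majorant[OF f, of n]) (rule that)
    have "Nev_N_on (\<lambda>z. f z ^ n) \<Lambda> \<le> ln 2"
    proof (rule Nev_N_on_le[of "\<lambda>_. ln 2"])
      show "ln (1 + norm (f w ^ n)) \<le> ln 2" if "w \<in> \<Lambda>" for w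
      proof -
        have "norm (f w ^ n) \<le> 1" using le1 that by (simp add: norm_power power_le_one)
        then show ?thesis by (subst ln_le_cancel_iff) (auto intro: add_pos_nonneg simp del: norm_power)
      qed
    qed (simp add: const_in_Har_plus)
    \<comment> \<open>The constant majorant \<open>ln 2\<close> works on \<open>\<Lambda>\<close>; the summand 1 leaves room to pick a near-optimal majorant.\<close>
    then have "Nev_N (\<lambda>z. f z ^ n) < ln 2 + C + 1" using C[OF k(3)] by simp
    then obtain h where h: "h \<in> Har_plus" "\<forall>z\<in>unit_disk. ln (1 + norm (f z ^ n)) \<le> h z"
      "h 0 < ln 2 + C + 1"
      unfolding Nev_N_def using k(1,2) by (elim cInf_lessD[rotated, THEN bexE]) blast+
    have "real n * log_plus (norm (f z)) = log_plus (norm (f z ^ n))"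
      by (simp add: norm_power log_plus_power)
    also have "\<dots> \<le> h z" by (rule order_trans[OF log_plus_le_ln]) (use h(2) z in auto)
    also have "\<dots> \<le> h 0 * (1 + norm z) / (1 - norm z)"
      using Harnack_inequality[OF h(1) z] z by (simp add: field_simps)
    also have "\<dots> \<le> B"
      unfolding B_def using h(3) z by (intro divide_right_mono mult_right_mono) (auto intro: add_nonneg_nonneg)
    finally show ?thesis .
  qed
  have "log_plus (norm (f z)) \<le> 0"
  proof (rule ccontr)
    assume "\<not> log_plus (norm (f z)) \<le> 0"
    then obtain n where "B < real n * log_plus (norm (f z))"
      using reals_Archimedean3 by (meson not_le)
    then show False using bound[of n] by simp
  qed
  then show "norm (f z) \<le> 1" by (simp add: log_plus_le_iff)
qed

text \<open>
  The values of \<open>G = \<zeta> / (\<zeta> - f)\<close> lie in the right half-plane. Hence \<open>|G| \<le> |1 + G|\<close> and \<open>1 \<le> |1 + G|\<close>, and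
  \<open>Re (Ln (1 + G))\<close> is a positive harmonic majorant of \<open>log\<^sup>+ |G|\<close>.
\<close>
lemma inverse_distance_in_Nevanlinna:
  assumes f: "f holomorphic_on unit_disk" and le: "\<And>z. z \<in> unit_disk \<Longrightarrow> norm (f z) \<le> norm \<zeta>"
    and nz: "\<And>z. z \<in> unit_disk \<Longrightarrow> f z \<noteq> \<zeta>" and "\<zeta> \<noteq> 0"
  shows "(\<lambda>z. \<zeta> / (\<zeta> - f z)) \<in> Nevanlinna"
proof -
  define G where "G z = \<zeta> / (\<zeta> - f z)" for z
  have G: "G holomorphic_on unit_disk"
    unfolding G_def using f nz
    by (intro holomorphic_on_divide holomorphic_on_diff holomorphic_on_const) auto
  have ReG: "0 \<le> Re (G z)" if "z \<in> unit_disk" for z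
  proof -
    define v where "v = 1 - f z / \<zeta>"
    have "norm (f z / \<zeta>) \<le> 1" using le[OF that] \<open>\<zeta> \<noteq> 0\<close> by (simp add: norm_divide)
    then have "0 \<le> Re v" using complex_Re_le_cmod[of "f z / \<zeta>"] by (simp add: v_def)
    moreover have "G z = inverse v" using \<open>\<zeta> \<noteq> 0\<close> nz[OF that] by (simp add: G_def v_def field_simps)
    ultimately show ?thesis by (simp add: inverse_complex.sel)
  qed
  have Re1: "1 \<le> Re (1 + G z)" if "z \<in> unit_disk" for z using ReG[OF that] by simp
  have no: "1 + G z \<notin> \<real>\<^sub>\<le>\<^sub>0" "1 + G z \<noteq> 0" "1 \<le> norm (1 + G z)" "norm (G z) \<le> norm (1 + G z)"
    if "z \<in> unit_disk" for z
  proof -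
    note r = ReG[OF that]
    show "1 + G z \<notin> \<real>\<^sub>\<le>\<^sub>0" using r by (auto simp: complex_nonpos_Reals_iff)
    show "1 + G z \<noteq> 0" using r by (auto simp: complex_eq_iff)
    show "1 \<le> norm (1 + G z)" using r complex_Re_le_cmod[of "1 + G z"] by simp
    have "(norm (G z))\<^sup>2 \<le> (norm (1 + G z))\<^sup>2"
      using r by (simp only: cmod_power2 plus_complex.sel one_complex.sel) (simp add: power2_eq_square algebra_simps)
    then show "norm (G z) \<le> norm (1 + G z)" by (rule power2_le_imp_le) simp
  qed
  define k where "k z = Ln (1 + G z)" for z
  have k: "k holomorphic_on unit_disk"
    unfolding k_def using no(1) G
    by (intro holomorphic_on_Ln' holomorphic_on_add holomorphic_on_const) auto
  have Rek: "Re (k z) = ln (norm (1 + G z))" if "z \<in> unit_disk" for z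
    using no(2)[OF that] by (simp add: k_def)
  have "(\<lambda>z. Re (k z)) \<in> Har_plus"
    by (rule Re_in_Har_plus[OF k]) (simp add: Rek no)
  moreover have "log_plus (norm (G z)) \<le> Re (k z)" if "z \<in> unit_disk" for z
  proof -
    have "log_plus (norm (G z)) \<le> log_plus (norm (1 + G z))"
      by (rule log_plus_mono) (use no(4)[OF that] in auto)
    also have "\<dots> = Re (k z)" using no(3)[OF that] by (simp add: log_plus_eq Rek[OF that])
    finally show ?thesis .
  qed
  ultimately have "G \<in> Nevanlinna" by (rule Nevanlinna_if_majorant[OF G])
  then show ?thesis by (simp add: G_def[abs_def])
qed

text \<open>
  Let \<open>\<zeta>\<close> have maximal modulus in the closure of the range of \<open>f\<close>. Since \<open>f\<close> is not constant, it does not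
  attain \<open>\<zeta>\<close>, but it comes arbitrarily close to it. On \<open>\<Lambda>\<close> it stays at distance at least \<open>|\<zeta>| - 1\<close>. So
  \<open>\<zeta> / (\<zeta> - f)\<close> is bounded on \<open>\<Lambda>\<close> and not on the disk.
\<close>
lemma not_determination_if_nonconstant:
  assumes f: "f holomorphic_on unit_disk" "bounded (f ` unit_disk)" "\<not> f constant_on unit_disk"
    and on: "\<Lambda> \<subseteq> unit_disk" "\<And>w. w \<in> \<Lambda> \<Longrightarrow> norm (f w) \<le> 1"
    and z0: "z0 \<in> unit_disk" "1 < norm (f z0)"
  shows "\<not> determination_set \<Lambda>"
proof
  assume det: "determination_set \<Lambda>"
  define K where "K = closure (f ` unit_disk)"
  have fK: "f z \<in> K" if "z \<in> unit_disk" for z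
    unfolding K_def by (rule subsetD[OF closure_subset imageI[OF that]])
  have "compact K" using f(2) by (simp add: K_def compact_closure)
  moreover have "K \<noteq> {}" using fK[OF z0(1)] by blast
  ultimately have "\<exists>\<zeta>\<in>K. \<forall>y\<in>K. norm y \<le> norm \<zeta>"
    by (rule continuous_attains_sup) (rule continuous_on_norm_id)
  then obtain \<zeta> where \<zeta>: "\<zeta> \<in> K" "\<forall>y\<in>K. norm y \<le> norm \<zeta>" by (rule bexE)
  have le: "norm (f z) \<le> norm \<zeta>" if "z \<in> unit_disk" for z
    using \<zeta>(2) fK[OF that] by (rule bspec)
  have gt1: "1 < norm \<zeta>" using le[OF z0(1)] z0(2) by simp
  have nz: "f z \<noteq> \<zeta>" if "z \<in> unit_disk" for z
  proof
    assume "f z = \<zeta>"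
    then have "f constant_on unit_disk"
      by (intro maximum_modulus_principle[OF f(1) open_ball connected_ball open_ball subset_refl that])
         (use le in auto)
    then show False using f(3) by simp
  qed
  define G where "G z = \<zeta> / (\<zeta> - f z)" for z
  have "G \<in> Nevanlinna"
    unfolding G_def by (rule inverse_distance_in_Nevanlinna[OF f(1) le nz]) (use gt1 in auto)
  moreover have "bdd_above ((\<lambda>z. norm (G z)) ` \<Lambda>)"
  proof (rule bdd_aboveI2)
    fix w assume w: "w \<in> \<Lambda>"
    have "norm \<zeta> - 1 \<le> norm (\<zeta> - f w)"
      using norm_triangle_ineq2[of \<zeta> "f w"] on(2)[OF w] by simp
    then show "norm (G w) \<le> norm \<zeta> / (norm \<zeta> - 1)"
      unfolding G_def norm_divide using gt1
      by (intro divide_left_mono mult_pos_pos) linarith+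
  qed
  ultimately have "G \<in> H_infinity" using det by (simp add: determination_set_def)
  then obtain B where B: "0 < B" "\<And>z. z \<in> unit_disk \<Longrightarrow> norm (G z) \<le> B"
    unfolding H_infinity_def bounded_pos by auto
  have "0 < norm \<zeta> / B" using B(1) gt1 by (intro divide_pos_pos) auto
  then obtain z where z: "z \<in> unit_disk" "dist (f z) \<zeta> < norm \<zeta> / B"
    using \<zeta>(1) unfolding K_def closure_approachable by blast
  have "0 < norm (\<zeta> - f z)" using nz[OF z(1)] by auto
  moreover have "norm (\<zeta> - f z) < norm \<zeta> / B" using z(2) by (simp add: dist_norm norm_minus_commute)
  ultimately have "B < norm (G z)"
    using B(1) by (simp add: G_def norm_divide field_simps)
  then show False using B(2)[OF z(1)] by simp
qed

text \<open>
  A constant of modulus greater than \<open>1\<close> can only satisfy the bound on an empty \<open>\<Lambda>\<close>; then \<open>2 z\<close> serves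
  as the non-constant function.
\<close>
lemma determination_imp_propagates_unit_bound:
  assumes det: "determination_set \<Lambda>" and "\<Lambda> \<subseteq> unit_disk"
  shows "propagates_unit_bound \<Lambda>"
  unfolding propagates_unit_bound_def
proof (intro ballI impI, rule ccontr)
  fix f z0
  assume f: "f \<in> Nevanlinna" and le1: "\<forall>w\<in>\<Lambda>. norm (f w) \<le> 1"
    and z0: "z0 \<in> unit_disk" and "\<not> norm (f z0) \<le> 1"
  then have gt1: "1 < norm (f z0)" by simp
  show False
  proof (cases "f constant_on unit_disk")
    case True
    then have const: "f w = f z0" if "w \<in> unit_disk" for w
      using that z0 unfolding constant_on_def by metis
    have "\<Lambda> = {}"
    proof (rule equals0I)
      fix w assume "w \<in> \<Lambda>"
      then have "norm (f w) \<le> 1" "f w = f z0" using le1 assms(2) const by auto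
      then show False using gt1 by simp
    qed
    have "\<not> determination_set \<Lambda>"
    proof (rule not_determination_if_nonconstant[of "\<lambda>z. 2 * z" _ "3 / 4"])
      show "(\<lambda>z::complex. 2 * z) holomorphic_on unit_disk"
        by (intro holomorphic_intros)
      show "bounded ((\<lambda>z::complex. 2 * z) ` unit_disk)"
        by (rule boundedI[of _ 2]) (auto simp: norm_mult)
      show "\<not> (\<lambda>z::complex. 2 * z) constant_on unit_disk"
      proof
        assume "(\<lambda>z::complex. 2 * z) constant_on unit_disk"
        then obtain c :: complex where c: "\<And>z. z \<in> unit_disk \<Longrightarrow> 2 * z = c"
          unfolding constant_on_def by blast
        show False using c[of 0] c[of "1 / 2"] by simp
      qed
    qed (use \<open>\<Lambda> = {}\<close> in auto)
    then show False using det by simp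
  next
    case False
    have "f \<in> H_infinity"
      using det f le1 unfolding determination_set_def by (auto simp: bdd_above_def)
    then have "\<not> determination_set \<Lambda>"
      using False assms(2) le1 z0 gt1
      by (intro not_determination_if_nonconstant[of f \<Lambda> z0]) (auto simp: H_infinity_def)
    then show False using det by simp
  qed
qed

section \<open>Strong sampling and the equivalences\<close>

text \<open>
  With \<open>h = Re g\<close>, the inequality \<open>log\<^sup>+ |f| \<le> h\<close> is the unit bound for \<open>F = f / exp g\<close>. The function \<open>F\<close> is in
  the Nevanlinna class because \<open>|exp g| \<ge> 1\<close>.
\<close>
lemma propagates_unit_bound_imp_strongly_sampling:
  assumes bound: "propagates_unit_bound \<Lambda>" and "\<Lambda> \<subseteq> unit_disk"
  shows "strongly_sampling_set \<Lambda>"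
  unfolding strongly_sampling_set_def
proof (intro ballI impI)
  fix f h z
  assume f: "f \<in> Nevanlinna" and h: "h \<in> Har_plus"
    and le: "\<forall>w\<in>\<Lambda>. log_plus (norm (f w)) \<le> h w" and z: "z \<in> unit_disk"
  obtain g where g: "g holomorphic_on unit_disk" "Im (g 0) = 0"
    "\<And>z. z \<in> unit_disk \<Longrightarrow> h z = Re (g z)" "\<And>z. z \<in> unit_disk \<Longrightarrow> 0 \<le> Re (g z)"
    by (rule Har_plus_eq_Re[OF h]) (rule that)
  define F where "F z = f z / exp (g z)" for z
  have nF: "norm (F w) = norm (f w) / exp (h w)" if "w \<in> unit_disk" for w
    by (simp add: F_def norm_divide g(3)[OF that])
  have h0: "0 \<le> h w" if "w \<in> unit_disk" for w using g(3,4)[OF that] by simp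
  have iff: "norm (F w) \<le> 1 \<longleftrightarrow> log_plus (norm (f w)) \<le> h w" if "w \<in> unit_disk" for w
    using h0[OF that] by (simp add: nF[OF that] log_plus_le_iff)
  obtain k where k: "k \<in> Har_plus" "\<And>z. z \<in> unit_disk \<Longrightarrow> log_plus (norm (f z)) \<le> k z"
    by (rule Nevanlinna_has_majorant[OF f]) (rule that)
  have "F \<in> Nevanlinna"
  proof (rule Nevanlinna_if_majorant[OF _ k(1)])
    show "F holomorphic_on unit_disk"
      unfolding F_def using Nevanlinna_holomorphic[OF f] g(1)
      by (intro holomorphic_on_divide holomorphic_on_exp') auto
    show "log_plus (norm (F w)) \<le> k w" if "w \<in> unit_disk" for w
    proof (rule order_trans[OF log_plus_mono k(2)[OF that]])
      have "norm (f w) / exp (h w) \<le> norm (f w) / 1"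
        using h0[OF that] by (intro divide_left_mono) auto
      then show "norm (F w) \<le> norm (f w)" by (simp add: nF[OF that])
    qed simp
  qed
  moreover have "\<forall>w\<in>\<Lambda>. norm (F w) \<le> 1" using le iff assms(2) by blast
  ultimately have "norm (F z) \<le> 1" using bound z unfolding propagates_unit_bound_def by blast
  then show "log_plus (norm (f z)) \<le> h z" using iff[OF z] by simp
qed

lemma strongly_samplingD:
  assumes "strongly_sampling_set \<Lambda>" "f \<in> Nevanlinna" "h \<in> Har_plus"
    and "\<And>w. w \<in> \<Lambda> \<Longrightarrow> log_plus (norm (f w)) \<le> h w" "z \<in> unit_disk"
  shows "log_plus (norm (f z)) \<le> h z"
  using assms unfolding strongly_sampling_set_def by simp

text \<open>
  A bound \<open>M\<close> on \<open>\<Lambda>\<close> is a bound by the constant harmonic function \<open>log\<^sup>+ M\<close>, which then holds everywhere.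
\<close>
lemma strongly_sampling_imp_determination:
  assumes "strongly_sampling_set \<Lambda>"
  shows "determination_set \<Lambda>"
  unfolding determination_set_def
proof (intro ballI impI)
  fix f assume f: "f \<in> Nevanlinna" and "bdd_above ((\<lambda>z. norm (f z)) ` \<Lambda>)"
  then obtain M where M: "\<And>w. w \<in> \<Lambda> \<Longrightarrow> norm (f w) \<le> M" by (auto simp: bdd_above_def)
  have on: "log_plus (norm (f w)) \<le> log_plus M" if "w \<in> \<Lambda>" for w
    by (rule log_plus_mono[OF norm_ge_zero M[OF that]])
  have "log_plus (norm (f z)) \<le> log_plus M" if "z \<in> unit_disk" for z
    by (rule strongly_samplingD[OF assms f const_in_Har_plus[OF log_plus_nonneg[of M]] _ that]) (rule on)
  then have "norm (f z) \<le> exp (log_plus M)" if "z \<in> unit_disk" for z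
    using that log_plus_le_iff[of "norm (f z)" "log_plus M"] log_plus_nonneg by simp
  then have "bounded (f ` unit_disk)" by (intro boundedI[of _ "exp (log_plus M)"]) blast
  then show "f \<in> H_infinity" using Nevanlinna_holomorphic[OF f] by (simp add: H_infinity_def)
qed

text \<open>
  A majorant \<open>h\<close> on \<open>\<Lambda>\<close> gives the majorant \<open>h + ln 2\<close> on the disk, because \<open>log\<^sup>+ x \<le> log (1 + x) \<le> ln 2 + log\<^sup>+ x\<close>.
  So the sampling constant can be taken to be \<open>ln 2\<close>.
\<close>
lemma strongly_sampling_imp_sampling:
  assumes strong: "strongly_sampling_set \<Lambda>" and "\<Lambda> \<subseteq> unit_disk"
  shows "sampling_set \<Lambda>"
  unfolding sampling_set_def
proof (intro exI conjI ballI)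
  show "0 < ln (2 :: real)" by simp
  fix f assume f: "f \<in> Nevanlinna"
  define S where "S = {h 0 | h. h \<in> Har_plus \<and> (\<forall>w\<in>\<Lambda>. ln (1 + norm (f w)) \<le> h w)}"
  have "Nev_N f - ln 2 \<le> Inf S"
  proof (rule cInf_greatest)
    obtain h where h: "h \<in> Har_plus" "\<And>z. z \<in> unit_disk \<Longrightarrow> ln (1 + norm (f z ^ 1)) \<le> h z"
      by (rule Nevanlinna_power_majorant[OF f, of 1]) (rule that)
    have "ln (1 + norm (f w)) \<le> h w" if "w \<in> \<Lambda>" for w
      using h(2)[of w] that assms(2) by auto
    then show "S \<noteq> {}" using h(1) unfolding S_def by blast
  next
    fix x assume "x \<in> S"
    then obtain h where h: "h \<in> Har_plus" "x = h 0" "\<And>w. w \<in> \<Lambda> \<Longrightarrow> ln (1 + norm (f w)) \<le> h w"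
      by (auto simp: S_def)
    have on: "log_plus (norm (f w)) \<le> h w" if "w \<in> \<Lambda>" for w
      by (rule order_trans[OF log_plus_le_ln h(3)[OF that]]) simp
    have maj: "log_plus (norm (f z)) \<le> h z" if "z \<in> unit_disk" for z
      by (rule strongly_samplingD[OF strong f h(1) _ that]) (rule on)
    obtain k where k: "k \<in> Har_plus" "\<And>z. z \<in> unit_disk \<Longrightarrow> k z = ln 2 + 1 * h z"
      using affine_in_Har_plus[OF h(1), of "ln 2" 1] by auto
    have "Nev_N f \<le> k 0"
    proof (rule Nev_N_le[OF k(1)])
      show "ln (1 + norm (f w)) \<le> k w" if "w \<in> unit_disk" for w
        using ln_le_log_plus[of "norm (f w)"] maj[OF that] k(2)[OF that] by simp
    qed
    then show "Nev_N f - ln 2 \<le> x" using k(2)[of 0] h(2) by simp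
  qed
  then show "Nev_N f \<le> Nev_N_on f \<Lambda> + ln 2" by (simp add: Nev_N_on_def S_def)
qed

theorem theorem2p2:
  fixes \<Lambda> :: "complex set"
  assumes "\<Lambda> \<subseteq> unit_disk"
  shows "(sampling_set \<Lambda> \<longleftrightarrow> determination_set \<Lambda>) \<and>
         (determination_set \<Lambda> \<longleftrightarrow> strongly_sampling_set \<Lambda>)"
  using sampling_imp_propagates_unit_bound determination_imp_propagates_unit_bound
    propagates_unit_bound_imp_strongly_sampling strongly_sampling_imp_determination
    strongly_sampling_imp_sampling assms
  by blast

end
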